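(* Let $m\geq 2$ be an integer, let $n_1=m(m+1)$, $n_2=m(m+1)+1$, $n_3=(m+1)^2$, $n_4=(m+1)^2+1$, let $\mathfrak{S}_m=\langle n_1,n_2,n_3,n_4\rangle$ be the numerical semigroup they generate, let $K$ be a field and let $R=K[[t^{n_1},t^{n_2},t^{n_3},t^{n_4}]]$ with maximal ideal $\mathfrak{m}$. Let $HG_{\mathfrak{m}}(\mathfrak{S}_m)(x)$ be the Hilbert series of the tangent cone $G_{\mathfrak{m}}(\mathfrak{S}_m)$. Then $$HG_{\mathfrak{m}}(\mathfrak{S}_m)(x)=\frac{\sum_{k=1}^{m-1}(2k-1)x^k+mx^m}{1-x}.$$
   Context: The tangent cone is the associated graded ring $G_{\mathfrak{m}}(\mathfrak{S}_m)=\bigoplus_{n\geq 0}\mathfrak{m}^n/\mathfrak{m}^{n+1}$ of $R$, and its Hilbert series is $\sum_{n\geq 0}\dim_K(\mathfrak{m}^n/\mathfrak{m}^{n+1})\,x^n$.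
   Formalization: The printed numerator is false for every m ≥ 2 (its constant term is 0, but dim_K(R/m) = 1); it is replaced by 1 + sum_{k=1}^{m-1} (2k+1)x^k + m x^m. For m = 2 the series is (1+3x+2x^2)/(1-x), not (x+2x^2)/(1-x). *)

theory Defs
  imports
    "HOL-Algebra.Algebra"
    "HOL-Computational_Algebra.Formal_Power_Series"
begin

definition gen_weight :: "nat list \<Rightarrow> nat list \<Rightarrow> nat"
  where "gen_weight ns a = sum_list (map2 (*) a ns)"

definition gen_semigroup :: "nat list \<Rightarrow> nat set"
  where "gen_semigroup ns = {gen_weight ns a | a. length a = length ns}"

text \<open>
  The ring \<open>K[[t^n | n in ns]]\<close> of power series in the monomials \<open>t^n\<close>: its elements are the
  infinite sums over all exponent vectors \<open>a\<close> of \<open>c a * t^(a . ns)\<close>. When all entries of \<open>ns\<close> are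
  positive, every coefficient below is a finite sum.
\<close>

definition gen_series :: "nat list \<Rightarrow> 'k::field fps set"
  where "gen_series ns =
    {f. \<exists>c. \<forall>k. fps_nth f k = (\<Sum>a | length a = length ns \<and> gen_weight ns a = k. c a)}"

definition gen_ring :: "nat list \<Rightarrow> 'k::field fps ring"
  where "gen_ring ns =
    \<lparr>carrier = gen_series ns, monoid.mult = (*), one = 1, ring.zero = 0, add = (+)\<rparr>"

lemma finite_gen_weight:
  assumes "0 \<notin> set ns"
  shows "finite {a. length a = length ns \<and> gen_weight ns a = k}"
proof (rule finite_subset)
  have "a ! i \<le> gen_weight ns a" if "length a = length ns" "i < length a" for a i
  proof -
    have "a ! i \<le> a ! i * ns ! i"
      using assms that by (metis gr0I mult_le_mono2 nat_mult_1_right nth_mem Suc_leI One_nat_def)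
    also have "a ! i * ns ! i = map2 (*) a ns ! i" using that by simp
    also have "\<dots> \<le> sum_list (map2 (*) a ns)"
      by (rule elem_le_sum_list) (use that in simp)
    finally show ?thesis by (simp add: gen_weight_def)
  qed
  then show "{a. length a = length ns \<and> gen_weight ns a = k} \<subseteq>
      {a. set a \<subseteq> {..k} \<and> length a = length ns}"
    by (fastforce simp: in_set_conv_nth)
  show "finite {a. set a \<subseteq> {..k} \<and> length a = length ns}"
    by (rule finite_lists_length_eq) simp
qed

lemma gen_series_eq_support:
  assumes "0 \<notin> set ns"
  shows "gen_series ns = {f :: 'k::field fps. \<forall>k. fps_nth f k \<noteq> 0 \<longrightarrow> k \<in> gen_semigroup ns}"
    (is "_ = ?S")
proof (intro equalityI subsetI)
  fix f :: "'k fps" assume "f \<in> gen_series ns"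
  then obtain c where c: "\<And>k. fps_nth f k =
      (\<Sum>a | length a = length ns \<and> gen_weight ns a = k. c a)"
    unfolding gen_series_def by blast
  have "fps_nth f k = 0" if "k \<notin> gen_semigroup ns" for k
  proof -
    have "{a. length a = length ns \<and> gen_weight ns a = k} = {}"
      using that by (auto simp: gen_semigroup_def)
    then show ?thesis by (simp only: c sum.empty)
  qed
  then show "f \<in> ?S" by blast
next
  fix f :: "'k fps" assume f: "f \<in> ?S"
  define r where "r k = (SOME a. length a = length ns \<and> gen_weight ns a = k)" for k
  define c where "c a = (if a = r (gen_weight ns a) then fps_nth f (gen_weight ns a) else 0)" for a
  have "fps_nth f k = (\<Sum>a | length a = length ns \<and> gen_weight ns a = k. c a)" for k
  proof (cases "k \<in> gen_semigroup ns")
    case True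
    then have "\<exists>a. length a = length ns \<and> gen_weight ns a = k"
      unfolding gen_semigroup_def by blast
    from someI_ex[OF this] have r: "length (r k) = length ns \<and> gen_weight ns (r k) = k"
      unfolding r_def .
    have "(\<Sum>a | length a = length ns \<and> gen_weight ns a = k. c a) =
        (\<Sum>a | length a = length ns \<and> gen_weight ns a = k. if r k = a then fps_nth f k else 0)"
      by (rule sum.cong) (auto simp: c_def)
    also have "\<dots> = fps_nth f k"
      using r by (simp add: sum.delta'[OF finite_gen_weight[OF assms]])
    finally show ?thesis by simp
  next
    case False
    then have e: "{a. length a = length ns \<and> gen_weight ns a = k} = {}"
      by (auto simp: gen_semigroup_def)
    from False f have "fps_nth f k = 0" by blast
    then show ?thesis by (simp only: e sum.empty)
  qed
  then show "f \<in> gen_series ns" unfolding gen_series_def by blast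
qed

text \<open>
  In the following, \<open>R\<close> is a local ring with maximal ideal \<open>M\<close>, and \<open>K\<close> is a subfield of \<open>R\<close>. The power
  \<open>M^n\<close> is taken in the multiplicative monoid of ideals; in particular \<open>M^0 = R\<close>. The degree \<open>n\<close> piece
  \<open>M^n / M^(n+1)\<close> of the associated graded ring is represented as a subset of \<open>R / M^(n+1)\<close>, of which
  it is a subspace over (the isomorphic image of) \<open>K\<close>.
\<close>

definition ideal_pow :: "('a, 'b) ring_scheme \<Rightarrow> 'a set \<Rightarrow> nat \<Rightarrow> 'a set"
  where "ideal_pow R M n = M [^]\<^bsub>ideals_set R\<^esub> n"

definition tangent_cone_piece :: "('a, 'b) ring_scheme \<Rightarrow> 'a set \<Rightarrow> nat \<Rightarrow> 'a set set"
  where "tangent_cone_piece R M n = (\<lambda>x. ideal_pow R M (Suc n) +>\<^bsub>R\<^esub> x) ` ideal_pow R M n"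

definition tangent_cone_dim :: "'a set \<Rightarrow> ('a, 'b) ring_scheme \<Rightarrow> 'a set \<Rightarrow> nat \<Rightarrow> nat"
  where "tangent_cone_dim K R M n =
    ring.dim (R Quot ideal_pow R M (Suc n))
      ((\<lambda>c. ideal_pow R M (Suc n) +>\<^bsub>R\<^esub> c) ` K) (tangent_cone_piece R M n)"

definition tangent_cone_hilbert_series :: "'a set \<Rightarrow> ('a, 'b) ring_scheme \<Rightarrow> 'a set \<Rightarrow> rat fps"
  where "tangent_cone_hilbert_series K R M = Abs_fps (\<lambda>n. of_nat (tangent_cone_dim K R M n))"

text \<open>
  Pitfall: the published numerator for \<open>ns = [m(m+1), m(m+1)+1, (m+1)^2, (m+1)^2+1]\<close> reads
  \<open>(sum k=1..m-1. (2k-1) x^k) + m x^m\<close>. It has constant term 0 and value \<open>m^2-m+1\<close> at \<open>x = 1\<close>, while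
  the Hilbert series has constant term \<open>dim (R/M) = 1\<close> and the multiplicity of \<open>R\<close> is \<open>m(m+1)\<close>. The
  statement is therefore about the corrected numerator
  \<open>1 + (sum k=1..m-1. (2k+1) x^k) + m x^m\<close>.
\<close>

end

theory Submission
  imports Defs
begin

text \<open>
  The ring consists of the power series supported on the semigroup \<open>S\<close>, and its maximal ideal of those
  supported on \<open>S - {0}\<close>. Hence \<open>M^n\<close> consists of the series supported on the sums of at least \<open>n\<close>
  generators, and \<open>dim (M^n / M^(n+1))\<close> counts the sums of \<open>n\<close> generators that are not sums of more
  than \<open>n\<close>. With \<open>b = m(m+1)\<close> the generators are \<open>b + p + q(m+1)\<close> with \<open>p, q \<in> {0, 1}\<close>, so the sums of
  exactly \<open>k\<close> generators are the numbers \<open>kb + i + j(m+1)\<close> with \<open>i, j \<le> k\<close>. If \<open>n < m\<close>, these \<open>(n+1)^2\<close>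
  numbers for \<open>k = n\<close> are distinct and all lie below \<open>(n+1)b\<close>. If \<open>n \<ge> m\<close>, the sums of at least \<open>n\<close>
  generators are all the numbers from \<open>nb\<close> on, so there are \<open>b\<close> new ones.
\<close>

section \<open>Power series with prescribed exponents\<close>

definition supported_on :: "nat set \<Rightarrow> 'k::field fps set"
  where "supported_on S = {f. \<forall>k. fps_nth f k \<noteq> 0 \<longrightarrow> k \<in> S}"

definition supp_ring :: "nat set \<Rightarrow> 'k::field fps ring"
  where "supp_ring S =
    \<lparr>carrier = supported_on S, monoid.mult = (*), one = 1, ring.zero = 0, add = (+)\<rparr>"

lemma supp_ring_simps [simp]:
  "carrier (supp_ring S) = supported_on S"
  "x \<otimes>\<^bsub>supp_ring S\<^esub> y = x * y"
  "x \<oplus>\<^bsub>supp_ring S\<^esub> y = x + y"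
  "\<one>\<^bsub>supp_ring S\<^esub> = 1"
  "\<zero>\<^bsub>supp_ring S\<^esub> = 0"
  by (simp_all add: supp_ring_def)

lemma supported_onI: "(\<And>k. fps_nth f k \<noteq> 0 \<Longrightarrow> k \<in> S) \<Longrightarrow> f \<in> supported_on S"
  by (auto simp: supported_on_def)

lemma supported_onD: "f \<in> supported_on S \<Longrightarrow> fps_nth f k \<noteq> 0 \<Longrightarrow> k \<in> S"
  by (auto simp: supported_on_def)

lemma supported_on_mono: "S \<subseteq> T \<Longrightarrow> supported_on S \<subseteq> supported_on T"
  by (auto simp: supported_on_def)

lemma supported_on_0 [simp]: "0 \<in> supported_on S"
  by (simp add: supported_on_def)

lemma supported_on_const: "0 \<in> S \<Longrightarrow> fps_const c \<in> supported_on S"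
  by (simp add: supported_on_def)

lemma supported_on_X_power: "k \<in> S \<Longrightarrow> fps_X ^ k \<in> supported_on S"
  by (simp add: supported_on_def)

lemma supported_on_uminus: "f \<in> supported_on S \<Longrightarrow> - f \<in> supported_on S"
  by (simp add: supported_on_def)

lemma supported_on_add: "f \<in> supported_on S \<Longrightarrow> g \<in> supported_on S \<Longrightarrow> f + g \<in> supported_on S"
  by (rule supported_onI) (metis fps_add_nth add_0 supported_onD)

lemma supported_on_mult:
  assumes "f \<in> supported_on S" "g \<in> supported_on T" "\<And>s t. s \<in> S \<Longrightarrow> t \<in> T \<Longrightarrow> s + t \<in> U"
  shows "f * g \<in> supported_on U"
proof (rule supported_onI)
  fix k assume "fps_nth (f * g) k \<noteq> 0"
  then obtain i where "i \<le> k" "fps_nth f i * fps_nth g (k - i) \<noteq> 0"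
    unfolding fps_mult_nth by (metis (no_types, lifting) sum.neutral atLeastAtMost_iff)
  then show "k \<in> U"
    using supported_onD[OF assms(1), of i] supported_onD[OF assms(2), of "k - i"]
      assms(3)[of i "k - i"] by auto
qed

lemma supported_on_smult: "f \<in> supported_on S \<Longrightarrow> fps_const c * f \<in> supported_on S"
  by (auto simp: supported_on_def)

section \<open>The ring of series with exponents in a monoid, its maximal ideal and ideal
  products\<close>

locale exponent_monoid =
  fixes S :: "nat set"
  assumes zero_mem: "0 \<in> S" and add_mem: "s \<in> S \<Longrightarrow> t \<in> S \<Longrightarrow> s + t \<in> S"
begin

lemma supp_cring: "cring (supp_ring S :: 'k::field fps ring)"
proof (rule cringI)
  show "abelian_group (supp_ring S :: 'k fps ring)"
    by (rule abelian_groupI)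
      (auto simp: algebra_simps supported_on_add intro!: bexI[of _ "- _"] supported_on_uminus)
  have "1 \<in> (supported_on S :: 'k fps set)"
    using supported_on_const[OF zero_mem, of 1] by simp
  then show "comm_monoid (supp_ring S :: 'k fps ring)"
    by (intro comm_monoidI) (auto simp: algebra_simps intro: supported_on_mult add_mem)
qed (auto simp: algebra_simps)

lemma supp_uminus [simp]:
  assumes "f \<in> supported_on S"
  shows "\<ominus>\<^bsub>supp_ring S\<^esub> f = - f"
proof -
  interpret cring "supp_ring S :: 'a fps ring" by (rule supp_cring)
  show ?thesis
    using minus_equality[of "- f" f] assms supported_on_uminus[OF assms] by simp
qed

lemma supp_ideal:
  assumes "T \<subseteq> S" "\<And>s t. s \<in> S \<Longrightarrow> t \<in> T \<Longrightarrow> s + t \<in> T"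
  shows "ideal (supported_on T) (supp_ring S :: 'k::field fps ring)"
proof -
  interpret cring "supp_ring S :: 'k fps ring" by (rule supp_cring)
  note sub = subsetD[OF supported_on_mono[OF assms(1)]]
  show ?thesis
  proof (rule idealI)
    show "subgroup (supported_on T) (add_monoid (supp_ring S :: 'k fps ring))"
    proof (rule add.subgroupI)
      show "\<ominus>\<^bsub>supp_ring S\<^esub> f \<in> supported_on T" if "f \<in> supported_on T" for f :: "'k fps"
        using that sub[OF that] by (simp add: supported_on_uminus)
    qed (auto simp: sub supported_on_add intro: supported_on_0)
  next
    fix a x :: "'k fps" assume "a \<in> supported_on T" "x \<in> carrier (supp_ring S)"
    then have "x * a \<in> supported_on T"
      using assms(2) by (intro supported_on_mult[of x S a T]) auto
    then show "x \<otimes>\<^bsub>supp_ring S\<^esub> a \<in> supported_on T" "a \<otimes>\<^bsub>supp_ring S\<^esub> x \<in> supported_on T"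
      by (simp_all add: mult.commute)
  qed (rule ring_axioms)
qed

text \<open>For k > 0, comparing coefficients in \<open>f * inverse f = 1\<close> expresses the k-th
  coefficient of the inverse through products of the coefficient of \<open>f\<close> at some i >= 1
  and that of the inverse at k - i. If it is nonzero, so is one of these products, and by induction
  k is a sum of two elements of \<open>S\<close>.\<close>

lemma supported_on_inverse:
  fixes f :: "'k::field fps"
  assumes f: "f \<in> supported_on S" and nz: "fps_nth f 0 \<noteq> 0"
  shows "inverse f \<in> supported_on S"
proof (rule supported_onI)
  fix k show "fps_nth (inverse f) k \<noteq> 0 \<Longrightarrow> k \<in> S"
  proof (induction k rule: less_induct)
    case (less k)
    show ?case
    proof (cases "k = 0")
      case False
      have "0 = fps_nth (f * inverse f) k"
        using False nz by (simp add: inverse_mult_eq_1')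
      also have "\<dots> = fps_nth f 0 * fps_nth (inverse f) k
          + (\<Sum>i = 1..k. fps_nth f i * fps_nth (inverse f) (k - i))"
        unfolding fps_mult_nth by (simp add: sum.atLeast_Suc_atMost)
      finally have "(\<Sum>i = 1..k. fps_nth f i * fps_nth (inverse f) (k - i)) \<noteq> 0"
        using less.prems nz by auto
      then obtain i where i: "i \<in> {1..k}" "fps_nth f i * fps_nth (inverse f) (k - i) \<noteq> 0"
        by (meson sum.neutral)
      then have "i \<in> S" "k - i \<in> S"
        using supported_onD[OF f] less.IH[of "k - i"] by auto
      then show ?thesis using add_mem[of i "k - i"] i by auto
    qed (simp add: zero_mem)
  qed
qed

text \<open>A series in the ring with nonzero constant term is a unit there, so a proper ideal
  contains only series without constant term. These form a proper ideal themselves, and maximality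
  forces equality.\<close>

lemma maximalideal_eq:
  fixes M :: "'k::field fps set"
  assumes "maximalideal M (supp_ring S)"
  shows "M = supported_on (S - {0})"
proof -
  interpret cring "supp_ring S :: 'k fps ring" by (rule supp_cring)
  interpret M: maximalideal M "supp_ring S :: 'k fps ring" by (rule assms)
  let ?N = "supported_on (S - {0}) :: 'k fps set"
  have N: "ideal ?N (supp_ring S)"
    by (rule supp_ideal) (use add_mem in auto)
  have "M \<subseteq> ?N"
  proof
    fix f assume f: "f \<in> M"
    then have fS: "f \<in> supported_on S" using M.Icarr by simp
    have "fps_nth f 0 = 0"
    proof (rule ccontr)
      assume nz: "fps_nth f 0 \<noteq> 0"
      have "f \<otimes>\<^bsub>supp_ring S\<^esub> inverse f \<in> M"
        using f supported_on_inverse[OF fS nz] by (intro M.I_r_closed) auto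
      then have "\<one>\<^bsub>supp_ring S\<^esub> \<in> M" using nz by (simp add: inverse_mult_eq_1')
      then show False using M.one_imp_carrier M.I_notcarr by auto
    qed
    with fS show "f \<in> ?N" by (auto simp: supported_on_def intro: gr0I)
  qed
  moreover have "?N \<subseteq> carrier (supp_ring S)" by (simp add: supported_on_mono)
  moreover have "1 \<in> carrier (supp_ring S :: 'k fps ring)" "1 \<notin> ?N"
    using one_closed by (simp_all add: supported_on_def)
  ultimately show ?thesis using M.I_maximal[OF N] by blast
qed

text \<open>Finiteness of \<open>G\<close> is what makes the sums in the ideal product finite.\<close>

lemma ideal_prod_supported_on:
  fixes G :: "nat set"
  assumes "finite G" "G \<subseteq> U"
    and sum: "\<And>t u. t \<in> T \<Longrightarrow> u \<in> U \<Longrightarrow> \<exists>g\<in>G. \<exists>t'\<in>T. t + u = g + t'"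
  shows "ideal_prod (supp_ring S) (supported_on T) (supported_on U) =
    (supported_on {g + t |g t. g \<in> G \<and> t \<in> T} :: 'k::field fps set)"
proof (intro equalityI subsetI)
  fix f :: "'k fps"
  assume "f \<in> ideal_prod (supp_ring S) (supported_on T) (supported_on U)"
  then show "f \<in> supported_on {g + t |g t. g \<in> G \<and> t \<in> T}"
  proof induction
    case (prod i j)
    have "i * j \<in> supported_on {g + t |g t. g \<in> G \<and> t \<in> T}"
      using prod by (rule supported_on_mult) (use sum in blast)
    then show ?case by simp
  next
    case (sum s1 s2)
    then show ?case by (simp add: supported_on_add)
  qed
next
  fix f :: "'k fps"
  assume "f \<in> supported_on {g + t |g t. g \<in> G \<and> t \<in> T}"
  with assms(1,2) show "f \<in> ideal_prod (supp_ring S) (supported_on T) (supported_on U)"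
  proof (induction G arbitrary: f rule: finite_induct)
    case empty
    then have "f = 0" by (auto simp: supported_on_def fps_eq_iff)
    then show ?case
      using ideal_prod.prod[of "0 :: 'k fps" "supported_on T" 0 "supported_on U" "supp_ring S"]
      by simp
  next
    case (insert g G)
    \<comment> \<open>\<open>h * fps_X ^ g\<close> carries all terms of \<open>f\<close> whose
      exponent lies in g + \<open>T\<close>. What is left is supported on sums of \<open>T\<close>
      with the remaining elements of \<open>G\<close>, so the induction hypothesis applies to
      it.\<close>
    define h where "h = Abs_fps (\<lambda>j. if j \<in> T then fps_nth f (j + g) else 0)"
    have h: "h \<in> supported_on T" by (auto simp: supported_on_def h_def)
    have "h \<otimes>\<^bsub>supp_ring S\<^esub> fps_X ^ g
        \<in> ideal_prod (supp_ring S) (supported_on T) (supported_on U)"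
      by (rule ideal_prod.prod[OF h]) (use insert.prems in \<open>auto intro: supported_on_X_power\<close>)
    moreover have "f - h * fps_X ^ g
        \<in> ideal_prod (supp_ring S) (supported_on T) (supported_on U)"
    proof (rule insert.IH)
      show "f - h * fps_X ^ g \<in> supported_on {g + t |g t. g \<in> G \<and> t \<in> T}"
      proof (rule supported_onI)
        fix k assume nz: "fps_nth (f - h * fps_X ^ g) k \<noteq> 0"
        then have "fps_nth f k \<noteq> 0" "\<not> (k \<ge> g \<and> k - g \<in> T)"
          by (auto simp: h_def fps_X_power_mult_right_nth split: if_splits)
        then show "k \<in> {g + t |g t. g \<in> G \<and> t \<in> T}"
          using supported_onD[OF insert.prems(2), of k] by auto
      qed
    qed (use insert.prems in auto)
    ultimately show ?case
      using ideal_prod.sum[of "h * fps_X ^ g" "supp_ring S" "supported_on T" "supported_on U"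
          "f - h * fps_X ^ g"] by simp
  qed
qed

section \<open>Dimension over the field of constants\<close>

lemma subfield_const: "subfield (range fps_const) (supp_ring S :: 'k::field fps ring)"
proof -
  let ?R = "supp_ring S :: 'k fps ring" and ?K = "range fps_const :: 'k fps set"
  interpret cring ?R by (rule supp_cring)
  have sub: "?K \<subseteq> supported_on S" using supported_on_const[OF zero_mem] by auto
  have "subring ?K ?R"
  proof (rule subringI)
    show "\<ominus>\<^bsub>?R\<^esub> h \<in> ?K" if "h \<in> ?K" for h
      using that subsetD[OF sub that] by auto
  qed (use sub in \<open>auto simp flip: fps_const_1_eq_1\<close>)
  then have "subcring ?K ?R" by (rule subcringI')
  moreover have "Units (?R \<lparr>carrier := ?K\<rparr>) = ?K - {\<zero>\<^bsub>?R\<^esub>}"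
  proof (intro equalityI subsetI)
    fix x assume "x \<in> Units (?R \<lparr>carrier := ?K\<rparr>)"
    then show "x \<in> ?K - {\<zero>\<^bsub>?R\<^esub>}" by (auto simp: Units_def)
  next
    fix x assume "x \<in> ?K - {\<zero>\<^bsub>?R\<^esub>}"
    then obtain c where c: "x = fps_const c" "c \<noteq> 0" by auto
    then show "x \<in> Units (?R \<lparr>carrier := ?K\<rparr>)"
      by (auto simp: Units_def intro!: exI[of _ "inverse c"])
  qed
  ultimately show ?thesis by (rule subfieldI)
qed

text \<open>The cosets of the monomials \<open>fps_X ^ d\<close> with d in \<open>T - T'\<close>
  form a basis. The dimension is built up by adjoining one of them at a time. The condition
  \<open>0 \<notin> T'\<close> keeps the quotient ring nontrivial, so that the image of the
  constants is again a field.\<close>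

lemma dim_quotient:
  fixes T T' :: "nat set"
  assumes I: "T' \<subseteq> S" "\<And>s t. s \<in> S \<Longrightarrow> t \<in> T' \<Longrightarrow> s + t \<in> T'" "0 \<notin> T'"
    and T: "T' \<subseteq> T" "T \<subseteq> S" "finite (T - T')"
  defines "J \<equiv> supported_on T' :: 'k::field fps set"
  shows "ring.dim (supp_ring S Quot J) ((\<lambda>c. J +>\<^bsub>supp_ring S\<^esub> c) ` range fps_const)
    ((\<lambda>x. J +>\<^bsub>supp_ring S\<^esub> x) ` supported_on T) = card (T - T')"
proof -
  let ?R = "supp_ring S :: 'k fps ring" and ?h = "\<lambda>x. J +>\<^bsub>supp_ring S\<^esub> x"
  interpret R: cring ?R by (rule supp_cring)
  interpret J: ideal J ?R unfolding J_def by (rule supp_ideal[OF I(1,2)])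
  interpret Q: ring "?R Quot J" by (rule J.quotient_is_ring)
  interpret h: ring_hom_ring ?R "?R Quot J" ?h by (rule J.rcos_ring_hom_ring)
  let ?K = "?h ` range fps_const"
  have eq_iff: "?h x = ?h y \<longleftrightarrow> x - y \<in> J" if "x \<in> supported_on S" "y \<in> supported_on S" for x y
  proof -
    have "x \<ominus>\<^bsub>?R\<^esub> y = x - y" using that by (simp add: a_minus_def)
    then show ?thesis
      using R.quotient_eq_iff_same_a_r_cos[OF J.is_ideal, of x y] that by simp
  qed
  have zero: "\<zero>\<^bsub>?R Quot J\<^esub> = J" by (simp add: FactRing_def)
  have h0: "?h x = J" if "x \<in> J" for x
    using that by (rule J.a_rcos_const)
  have "\<one>\<^bsub>?R Quot J\<^esub> \<noteq> \<zero>\<^bsub>?R Quot J\<^esub>"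
  proof
    assume "\<one>\<^bsub>?R Quot J\<^esub> = \<zero>\<^bsub>?R Quot J\<^esub>"
    then have "?h 1 = ?h 0" using h0[of 0] by (simp add: FactRing_def J_def)
    then have "1 \<in> J" using eq_iff[of 1 0] R.one_closed by simp
    then show False using I(3) supported_onD[of 1 T' 0] by (auto simp: J_def)
  qed
  then have K: "subfield ?K (?R Quot J)"
    by (rule h.img_is_subfield(2)[OF subfield_const])
  \<comment> \<open>The induction runs over arbitrary finite \<open>D\<close> disjoint from
    \<open>T'\<close>. The case \<open>D = T - T'\<close> gives the claim, since
    \<open>D \<union> T'\<close> is then \<open>T\<close>.\<close>
  have "finite D \<Longrightarrow> D \<subseteq> S \<Longrightarrow> D \<inter> T' = {} \<Longrightarrow>
      Q.dimension (card D) ?K (?h ` supported_on (D \<union> T'))" for D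
  proof (induction D rule: finite_induct)
    case empty
    have "?h ` supported_on T' = {J}"
    proof (intro equalityI subsetI)
      show "y \<in> {J}" if "y \<in> ?h ` supported_on T'" for y
        using that h0 by (auto simp: J_def)
      show "y \<in> ?h ` supported_on T'" if "y \<in> {J}" for y
        using that h0[of 0] by (intro image_eqI[of _ _ 0]) (auto simp: J_def)
    qed
    then show ?case using Q.zero_dim[of ?K] by (simp add: zero)
  next
    case (insert d D)
    let ?E = "?h ` supported_on (D \<union> T')"
    have sub: "supported_on (D \<union> T') \<subseteq> (supported_on S :: 'k fps set)"
      using insert.prems I(1) by (intro supported_on_mono) auto
    have d: "fps_X ^ d \<in> (supported_on S :: 'k fps set)"
      using insert.prems by (intro supported_on_X_power) auto
    \<comment> \<open>A series supported on \<open>D \<union> T'\<close> has coefficient 0 at d. Its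
      difference from \<open>fps_X ^ d\<close> thus has coefficient 1 there, and membership in
      \<open>J\<close> would put d into \<open>T'\<close>.\<close>
    have "?h (fps_X ^ d) \<notin> ?E"
    proof
      assume "?h (fps_X ^ d) \<in> ?E"
      then obtain f where f: "f \<in> supported_on (D \<union> T')" "?h (fps_X ^ d) = ?h f" by auto
      then have "fps_X ^ d - f \<in> J" using eq_iff[OF d, of f] sub by auto
      moreover have "fps_nth f d = 0"
        using supported_onD[OF f(1), of d] insert.prems insert.hyps by auto
      ultimately have "d \<in> T'" unfolding J_def by (intro supported_onD[of "fps_X ^ d - f"]) auto
      with insert.prems show False by auto
    qed
    moreover have "?h (fps_X ^ d) \<in> carrier (?R Quot J)" using d by simp
    moreover have "Q.dimension (card D) ?K ?E" using insert by auto
    ultimately have "Q.dimension (Suc (card D)) ?K (Q.line_extension ?K (?h (fps_X ^ d)) ?E)"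
      by (metis Q.Suc_dim)
    moreover have "Q.line_extension ?K (?h (fps_X ^ d)) ?E
        = ?h ` supported_on (insert d D \<union> T')"
    proof -
      have comb: "?h (fps_const c) \<otimes>\<^bsub>?R Quot J\<^esub> ?h (fps_X ^ d) \<oplus>\<^bsub>?R Quot J\<^esub> ?h f
          = ?h (fps_const c * fps_X ^ d + f)" if "f \<in> supported_on (D \<union> T')" for c f
        using d supported_on_const[OF zero_mem, of c] subsetD[OF sub that]
          R.m_closed[of "fps_const c" "fps_X ^ d"]
        by (simp flip: h.hom_mult h.hom_add)
      show ?thesis
      proof (intro equalityI subsetI)
        fix u assume "u \<in> Q.line_extension ?K (?h (fps_X ^ d)) ?E"
        then obtain c f where f: "f \<in> supported_on (D \<union> T')"
          "u = ?h (fps_const c * fps_X ^ d + f)"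
          by (auto simp: Q.line_extension_mem_iff comb)
        have "fps_const c * fps_X ^ d + f \<in> supported_on (insert d D \<union> T')"
          using subsetD[OF supported_on_mono[of "D \<union> T'" "insert d D \<union> T'"] f(1)]
          by (auto intro!: supported_on_add supported_on_smult supported_on_X_power)
        with f(2) show "u \<in> ?h ` supported_on (insert d D \<union> T')" by blast
      next
        fix u assume "u \<in> ?h ` supported_on (insert d D \<union> T')"
        then obtain f where f: "f \<in> supported_on (insert d D \<union> T')" "u = ?h f" by blast
        \<comment> \<open>Removing the term of exponent d splits \<open>f\<close> into a scalar
          multiple of the new basis vector and an element of the old span.\<close>
        let ?f = "f - fps_const (fps_nth f d) * fps_X ^ d"
        have "?f \<in> supported_on (D \<union> T')"
        proof (rule supported_onI)
          fix k assume "fps_nth ?f k \<noteq> 0"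
          then have "k \<noteq> d" "fps_nth f k \<noteq> 0" by (auto split: if_splits)
          then show "k \<in> D \<union> T'" using supported_onD[OF f(1)] by auto
        qed
        moreover from comb[OF this, of "fps_nth f d"]
        have "u = ?h (fps_const (fps_nth f d)) \<otimes>\<^bsub>?R Quot J\<^esub> ?h (fps_X ^ d)
            \<oplus>\<^bsub>?R Quot J\<^esub> ?h ?f"
          using f(2) by simp
        ultimately show "u \<in> Q.line_extension ?K (?h (fps_X ^ d)) ?E"
          unfolding Q.line_extension_mem_iff by blast
      qed
    qed
    ultimately show ?case using insert.hyps by simp
  qed
  moreover have "T - T' \<union> T' = T" using T(1) by blast
  ultimately have "Q.dimension (card (T - T')) ?K (?h ` supported_on T)"
    using T by (metis Diff_disjoint Diff_subset Int_commute subset_trans)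
  from Q.dimI[OF K this] show ?thesis by (simp add: over_def)
qed

end

section \<open>Sums of generators\<close>

fun nfold_sums :: "nat set \<Rightarrow> nat \<Rightarrow> nat set"
  where
    "nfold_sums G 0 = {0}"
  | "nfold_sums G (Suc k) = {g + a |g a. g \<in> G \<and> a \<in> nfold_sums G k}"

text \<open>The exponent set of the n-th power of the maximal ideal. Collecting all k >= n makes
  these sets decrease with n and absorb the addition of semigroup elements.\<close>

definition sums_ge :: "nat set \<Rightarrow> nat \<Rightarrow> nat set"
  where "sums_ge G n = (\<Union>k\<in>{n..}. nfold_sums G k)"

lemma nfold_sums_add: "a \<in> nfold_sums G k \<Longrightarrow> b \<in> nfold_sums G l \<Longrightarrow> a + b \<in> nfold_sums G (k + l)"
proof (induction k arbitrary: a)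
  case (Suc k)
  then obtain g c where "g \<in> G" "c \<in> nfold_sums G k" "a = g + c" by auto
  moreover then have "c + b \<in> nfold_sums G (k + l)" using Suc by blast
  ultimately show ?case by (auto simp: add.assoc)
qed auto

lemma nfold_sums_subset_sums_ge: "n \<le> k \<Longrightarrow> nfold_sums G k \<subseteq> sums_ge G n"
  by (auto simp: sums_ge_def)

lemma sums_ge_eq_Un: "sums_ge G n = nfold_sums G n \<union> sums_ge G (Suc n)"
proof -
  have "{n..} = insert n {Suc n..}" by auto
  then show ?thesis by (simp add: sums_ge_def)
qed

lemma zero_mem_sums_ge: "0 \<in> sums_ge G 0"
  using nfold_sums_subset_sums_ge[of 0 0 G] by simp

lemma sums_ge_add: "a \<in> sums_ge G n \<Longrightarrow> b \<in> sums_ge G l \<Longrightarrow> a + b \<in> sums_ge G (n + l)"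
  unfolding sums_ge_def by (auto intro: nfold_sums_add intro!: bexI[of _ "_ + _"])

lemma sums_ge_antimono: "n \<le> l \<Longrightarrow> sums_ge G l \<subseteq> sums_ge G n"
  by (fastforce simp: sums_ge_def)

text \<open>A sum of at least n + 1 generators has one to split off, which leaves at least n. The
  right-hand side has the shape produced by \<open>ideal_prod_supported_on\<close>, so the step from
  \<open>n\<close> to \<open>Suc n\<close> matches one multiplication by the maximal ideal.\<close>

lemma sums_ge_Suc: "sums_ge G (Suc n) = {g + t |g t. g \<in> G \<and> t \<in> sums_ge G n}"
proof (intro equalityI subsetI)
  fix x assume "x \<in> sums_ge G (Suc n)"
  then obtain k where k: "k \<ge> Suc n" "x \<in> nfold_sums G k" by (auto simp: sums_ge_def)
  then obtain l where "k = Suc l" by (cases k) auto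
  with k show "x \<in> {g + t |g t. g \<in> G \<and> t \<in> sums_ge G n}" by (auto simp: sums_ge_def)
next
  fix x assume "x \<in> {g + t |g t. g \<in> G \<and> t \<in> sums_ge G n}"
  then show "x \<in> sums_ge G (Suc n)" by (force simp: sums_ge_def intro: bexI[of _ "Suc _"])
qed

lemma mem_sums_ge_1: "g \<in> G \<Longrightarrow> g \<in> sums_ge G 1"
  by (auto simp: sums_ge_def intro!: bexI[of _ 1])

lemma zero_notin_sums_ge_Suc: "0 \<notin> G \<Longrightarrow> 0 \<notin> sums_ge G (Suc n)"
  by (auto simp: sums_ge_Suc)

lemma sums_ge_0_minus_0: "0 \<notin> G \<Longrightarrow> sums_ge G 0 - {0} = sums_ge G 1"
  using sums_ge_eq_Un[of G 0] zero_notin_sums_ge_Suc[of G 0] by auto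

lemma finite_nfold_sums: "finite G \<Longrightarrow> finite (nfold_sums G k)"
  by (induction k) (auto intro: finite_image_set2)

lemma finite_sums_ge_diff: "finite G \<Longrightarrow> finite (sums_ge G n - sums_ge G (Suc n))"
  using sums_ge_eq_Un[of G n] finite_nfold_sums[of G n] by (auto intro: finite_subset)

section \<open>Exponent vectors and iterated sums describe the same semigroup\<close>

lemma gen_weight_Cons [simp]: "gen_weight (n # ns) (x # a) = x * n + gen_weight ns a"
  by (simp add: gen_weight_def)

text \<open>Induction on the lists, then on the first entry \<open>x\<close> of the exponent vector:
  raising \<open>x\<close> by one adds another copy of the generator \<open>n\<close>.\<close>

lemma gen_weight_mem_sums_ge: "length a = length ns \<Longrightarrow> gen_weight ns a \<in> sums_ge (set ns) 0"
proof (induction a ns rule: list_induct2)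
  case Nil
  show ?case by (simp add: gen_weight_def zero_mem_sums_ge)
next
  case (Cons x a n ns)
  \<comment> \<open>The induction hypothesis speaks of sums of the generators in \<open>ns\<close>
    only; monotonicity carries it over to \<open>n # ns\<close>.\<close>
  have mono: "nfold_sums G k \<subseteq> nfold_sums H k" if "G \<subseteq> H" for G H k
    using that by (induction k) fastforce+
  have "gen_weight ns a \<in> sums_ge (set (n # ns)) 0"
    using Cons.IH mono[of "set ns" "set (n # ns)"] by (fastforce simp: sums_ge_def)
  then show ?case
  proof (induction x)
    case (Suc x)
    have "n + gen_weight (n # ns) (x # a) \<in> sums_ge (set (n # ns)) (Suc 0)"
      unfolding sums_ge_Suc using Suc by auto
    then have "n + gen_weight (n # ns) (x # a) \<in> sums_ge (set (n # ns)) 0"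
      using sums_ge_antimono[of 0 "Suc 0"] by blast
    then show ?case by (simp add: add.assoc)
  qed simp
qed

text \<open>Lets an iterated sum be turned into an exponent vector, one generator at a time.\<close>

lemma gen_weight_update:
  "length a = length ns \<Longrightarrow> i < length ns \<Longrightarrow>
    gen_weight ns (a[i := Suc (a ! i)]) = ns ! i + gen_weight ns a"
proof (induction a ns arbitrary: i rule: list_induct2)
  case (Cons x a n ns)
  then show ?case by (cases i) auto
qed simp

lemma gen_semigroup_eq_sums_ge: "gen_semigroup ns = sums_ge (set ns) 0"
proof (intro equalityI subsetI)
  fix x assume "x \<in> gen_semigroup ns"
  then show "x \<in> sums_ge (set ns) 0" by (auto simp: gen_semigroup_def gen_weight_mem_sums_ge)
next
  fix x assume "x \<in> sums_ge (set ns) 0"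
  then obtain k where "x \<in> nfold_sums (set ns) k" by (auto simp: sums_ge_def)
  then show "x \<in> gen_semigroup ns"
  proof (induction k arbitrary: x)
    case 0
    have "gen_weight ns (replicate (length ns) 0) = 0"
      by (induction ns) (simp_all add: gen_weight_def)
    then show ?case using 0 by (auto simp: gen_semigroup_def intro!: exI[of _ "replicate (length ns) 0"])
  next
    case (Suc k)
    then obtain g y where "g \<in> set ns" "y \<in> gen_semigroup ns" "x = g + y" by auto
    moreover then obtain i a where "i < length ns" "g = ns ! i" "length a = length ns"
      "y = gen_weight ns a" by (auto simp: gen_semigroup_def in_set_conv_nth)
    ultimately show ?case
      by (auto simp: gen_semigroup_def gen_weight_update intro!: exI[of _ "a[i := Suc (a ! i)]"])
  qed
qed

lemma gen_ring_eq_supp_ring: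
  "0 \<notin> set ns \<Longrightarrow> (gen_ring ns :: 'k::field fps ring) = supp_ring (sums_ge (set ns) 0)"
  by (simp add: gen_ring_def supp_ring_def supported_on_def gen_series_eq_support
      gen_semigroup_eq_sums_ge)

interpretation sums: exponent_monoid "sums_ge G 0" for G
proof
  show "0 \<in> sums_ge G 0" by (rule zero_mem_sums_ge)
  show "s + t \<in> sums_ge G 0" if "s \<in> sums_ge G 0" "t \<in> sums_ge G 0" for s t
    using sums_ge_add[OF that] by simp
qed

section \<open>Powers of the maximal ideal and the dimensions of the tangent cone\<close>

text \<open>Induction on \<open>n\<close>, multiplying by \<open>M\<close> at each step. The set
  \<open>G\<close> of \<open>ideal_prod_supported_on\<close> is the finite set of generators: a sum
  of at least n generators plus a sum of at least one is a generator plus a sum of at least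
  n.\<close>

lemma ideal_pow_gen_ring:
  fixes M :: "'k::field fps set"
  assumes ns: "0 \<notin> set ns" and M: "maximalideal M (gen_ring ns)"
  shows "ideal_pow (gen_ring ns) M n = supported_on (sums_ge (set ns) n)"
proof -
  let ?G = "set ns"
  note R = gen_ring_eq_supp_ring[OF ns]
  have M_eq: "M = supported_on (sums_ge ?G 1)"
    using sums.maximalideal_eq M unfolding R sums_ge_0_minus_0[OF ns, symmetric] by blast
  show ?thesis
  proof (induction n)
    case 0
    show ?case unfolding R by (simp add: ideal_pow_def ideals_set_def nat_pow_def)
  next
    case (Suc n)
    have "ideal_pow (supp_ring (sums_ge ?G 0)) M (Suc n)
        = ideal_prod (supp_ring (sums_ge ?G 0)) (supported_on (sums_ge ?G n)) (supported_on (sums_ge ?G 1))"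
      using Suc M_eq unfolding R by (simp add: ideal_pow_def ideals_set_def nat_pow_def)
    also have "\<dots> = supported_on {g + t |g t. g \<in> ?G \<and> t \<in> sums_ge ?G n}"
    proof (rule sums.ideal_prod_supported_on)
      fix t u assume "t \<in> sums_ge ?G n" "u \<in> sums_ge ?G 1"
      from sums_ge_add[OF this] show "\<exists>g\<in>?G. \<exists>t'\<in>sums_ge ?G n. t + u = g + t'"
        by (auto simp: sums_ge_Suc)
    qed (auto simp: mem_sums_ge_1 simp del: One_nat_def)
    finally show ?case unfolding R sums_ge_Suc .
  qed
qed

lemma tangent_cone_dim_gen_ring:
  fixes M :: "'k::field fps set"
  assumes ns: "0 \<notin> set ns" and M: "maximalideal M (gen_ring ns)"
  shows "tangent_cone_dim (range fps_const) (gen_ring ns) M n =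
    card (sums_ge (set ns) n - sums_ge (set ns) (Suc n))"
  unfolding tangent_cone_dim_def tangent_cone_piece_def ideal_pow_gen_ring[OF assms]
  unfolding gen_ring_eq_supp_ring[OF ns]
proof (rule sums.dim_quotient)
  show "s + t \<in> sums_ge (set ns) (Suc n)" if "s \<in> sums_ge (set ns) 0" "t \<in> sums_ge (set ns) (Suc n)" for s t
    using sums_ge_add[OF that] by simp
qed (simp_all add: sums_ge_antimono zero_notin_sums_ge_Suc ns finite_sums_ge_diff)

section \<open>Sums of the four generators\<close>

text \<open>The generators are b + p + q c with p and q chosen independently from {0, 1}. Over k
  summands the p and the q add up independently, and each total takes every value from 0 to
  k.\<close>

lemma nfold_sums_rectangle:
  "nfold_sums {b, b + 1, b + c, b + c + 1} k = {k * b + i + j * c |i j. i \<le> k \<and> j \<le> k}"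
proof (induction k)
  case (Suc k)
  show ?case
  proof (intro equalityI subsetI)
    fix x assume "x \<in> nfold_sums {b, b + 1, b + c, b + c + 1} (Suc k)"
    then obtain g a where g: "g \<in> {b, b + 1, b + c, b + c + 1}" and x: "x = g + a"
      and "a \<in> {k * b + i + j * c |i j. i \<le> k \<and> j \<le> k}"
      unfolding Suc.IH[symmetric] by auto
    then obtain i j where x: "x = g + (k * b + i + j * c)" and "i \<le> k" "j \<le> k" by blast
    from g have "g = b + 0 + 0 * c \<or> g = b + 1 + 0 * c \<or> g = b + 0 + 1 * c \<or> g = b + 1 + 1 * c"
      by auto
    then obtain p q where "p \<le> 1" "q \<le> 1" "g = b + p + q * c"
      using that[of 0 0] that[of 1 0] that[of 0 1] that[of 1 1] by auto
    then have "x = Suc k * b + (i + p) + (j + q) * c" "i + p \<le> Suc k" "j + q \<le> Suc k"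
      using x \<open>i \<le> k\<close> \<open>j \<le> k\<close> by (auto simp: algebra_simps)
    then show "x \<in> {Suc k * b + i + j * c |i j. i \<le> Suc k \<and> j \<le> Suc k}" by blast
  next
    fix x assume "x \<in> {Suc k * b + i + j * c |i j. i \<le> Suc k \<and> j \<le> Suc k}"
    then obtain i j where ij: "i \<le> Suc k" "j \<le> Suc k" and x: "x = Suc k * b + i + j * c" by auto
    \<comment> \<open>The generator to split off lowers each positive coordinate by one, so that
      even i = k + 1 or j = k + 1 drops to at most k.\<close>
    define p q where "p = (if i = 0 then 0 else 1 :: nat)" and "q = (if j = 0 then 0 else 1 :: nat)"
    have "i - p \<le> k" "j - q \<le> k" "b + p + q * c \<in> {b, b + 1, b + c, b + c + 1}"
      using ij by (auto simp: p_def q_def)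
    moreover have "x = b + p + q * c + (k * b + (i - p) + (j - q) * c)"
    proof -
      have "i = p + (i - p)" "j = q + (j - q)" by (auto simp: p_def q_def)
      then have "x = Suc k * b + (p + (i - p)) + (q + (j - q)) * c" using x by simp
      then show ?thesis by (simp add: algebra_simps)
    qed
    moreover from calculation(1,2)
    have "k * b + (i - p) + (j - q) * c \<in> nfold_sums {b, b + 1, b + c, b + c + 1} k"
      unfolding Suc.IH by (intro CollectI exI[of _ "j - q"] exI[of _ "i - p"]) simp
    ultimately show "x \<in> nfold_sums {b, b + 1, b + c, b + c + 1} (Suc k)"
      unfolding nfold_sums.simps
      by (intro CollectI exI[of _ "k * b + (i - p) + (j - q) * c"] exI[of _ "b + p + q * c"]) simp
  qed
qed auto

context
  fixes m :: nat and G :: "nat set"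
  assumes G: "G = {m * (m + 1), m * (m + 1) + 1, m * (m + 1) + (m + 1), m * (m + 1) + (m + 1) + 1}"
begin

lemma nfold_sums_G: "nfold_sums G k = {k * (m * (m + 1)) + i + j * (m + 1) |i j. i \<le> k \<and> j \<le> k}"
  unfolding G by (rule nfold_sums_rectangle)

lemma sums_ge_G_ge: "x \<in> sums_ge G n \<Longrightarrow> n * (m * (m + 1)) \<le> x"
  by (auto simp: sums_ge_def nfold_sums_G intro: trans_le_add1 mult_le_mono1)

text \<open>A sum of more than n generators is at least (n + 1)m(m + 1), which exceeds every sum of
  exactly n. The pairs (i, j) give distinct sums because i <= n < m makes i the remainder of i + j(m
  + 1) modulo m + 1.\<close>

lemma nfold_sums_G_small:
  assumes "n < m"
  shows "sums_ge G n - sums_ge G (Suc n) = nfold_sums G n" "card (nfold_sums G n) = (n + 1)^2"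
proof -
  \<comment> \<open>Here i + j(m + 1) <= n + n(m + 1) < (n + 1)(m + 1) <= m(m + 1).\<close>
  have "x < Suc n * (m * (m + 1))" if "x \<in> nfold_sums G n" for x
  proof -
    from that obtain i j where "x = n * (m * (m + 1)) + i + j * (m + 1)" "i \<le> n" "j \<le> n"
      by (auto simp: nfold_sums_G)
    moreover from this(3) have "j * (m + 1) \<le> n * (m + 1)" by (rule mult_le_mono1)
    moreover have "(n + 1) * (m + 1) \<le> m * (m + 1)" using assms by (intro mult_le_mono1) simp
    ultimately show ?thesis using assms by simp
  qed
  then show "sums_ge G n - sums_ge G (Suc n) = nfold_sums G n"
    using sums_ge_eq_Un[of G n] sums_ge_G_ge[of _ "Suc n"] by fastforce
  have "nfold_sums G n = (\<lambda>(i, j). n * (m * (m + 1)) + i + j * (m + 1)) ` ({..n} \<times> {..n})"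
    by (auto simp: nfold_sums_G)
  moreover have "i = i' \<and> j = j'"
    if "i \<le> n" "i' \<le> n" and eq: "i + j * (m + 1) = i' + j' * (m + 1)" for i j i' j'
  proof -
    have "(i + j * (m + 1)) mod (m + 1) = i" "(i' + j' * (m + 1)) mod (m + 1) = i'"
      using that(1,2) assms by (auto simp del: add_Suc_right simp: mod_mult_self1)
    then have "i = i'" using eq by metis
    moreover from this have "j * (m + 1) = j' * (m + 1)" using eq by simp
    ultimately show ?thesis unfolding mult_cancel2 by simp
  qed
  then have "inj_on (\<lambda>(i, j). n * (m * (m + 1)) + i + j * (m + 1)) ({..n} \<times> {..n})"
    by (intro inj_onI) (simp only: split_paired_all prod.case mem_Times_iff atMost_iff fst_conv
      snd_conv add.assoc add_left_cancel, blast)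
  ultimately show "card (nfold_sums G n) = (n + 1)^2"
    by (simp add: card_image power2_eq_square)
qed

text \<open>Division of x by m(m + 1) has a quotient k >= n. The remainder is i + j(m + 1) with i <=
  m and j < m, and m <= n <= k makes both admissible, so x is a sum of exactly k generators.\<close>

lemma sums_ge_G_large:
  assumes "m \<le> n" "0 < m"
  shows "sums_ge G n = {n * (m * (m + 1))..}"
proof (intro equalityI subsetI)
  fix x assume x: "x \<in> {n * (m * (m + 1))..}"
  define k r where "k = x div (m * (m + 1))" and "r = x mod (m * (m + 1))"
  have "n * (m * (m + 1)) div (m * (m + 1)) \<le> k"
    unfolding k_def using x by (intro div_le_mono) simp
  then have "n \<le> k" using assms by simp
  have "r < m * (m + 1)" unfolding r_def using assms by simp
  then have "r div (m + 1) < m" by (simp add: less_mult_imp_div_less)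
  then have "r div (m + 1) \<le> k" using \<open>n \<le> k\<close> assms by simp
  moreover have "r mod (m + 1) < m + 1" by (intro mod_less_divisor) simp
  then have "r mod (m + 1) \<le> k" using \<open>n \<le> k\<close> assms by linarith
  moreover have "x = k * (m * (m + 1)) + r mod (m + 1) + r div (m + 1) * (m + 1)"
    unfolding k_def r_def by (simp only: add.assoc mod_mult_div_eq mod_div_mult_eq div_mult_mod_eq)
  ultimately have "x \<in> nfold_sums G k" unfolding nfold_sums_G by blast
  with \<open>n \<le> k\<close> show "x \<in> sums_ge G n" by (auto simp: sums_ge_def)
qed (use sums_ge_G_ge in auto)

lemma card_sums_ge_G_diff:
  assumes "0 < m"
  shows "card (sums_ge G n - sums_ge G (Suc n)) = (if n < m then (n + 1)^2 else m * (m + 1))"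
proof (cases "n < m")
  case True
  then show ?thesis using nfold_sums_G_small by simp
next
  case False
  \<comment> \<open>Both \<open>n\<close> and \<open>Suc n\<close> are at least \<open>m\<close>, so
    this is a difference of two rays.\<close>
  then have "sums_ge G n - sums_ge G (Suc n) = {n * (m * (m + 1))..<Suc n * (m * (m + 1))}"
    using assms by (subst (1 2) sums_ge_G_large) auto
  then show ?thesis using False by simp
qed

end

section \<open>The generating function of the dimensions\<close>

text \<open>Multiplication by 1 - X takes successive differences of the coefficients: (n + 1)^2 -
  n^2 = 2n + 1 for n < m, then m(m + 1) - m^2 = m at n = m, and 0 beyond.\<close>

lemma hilbert_series_eq:
  assumes "0 < m"
  shows "Abs_fps (\<lambda>n. of_nat (if n < m then (n + 1)^2 else m * (m + 1))) =
    (1 + (\<Sum>k = 1..m - 1. of_nat (2 * k + 1) * fps_X ^ k) + of_nat m * fps_X ^ m) /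
    (1 - fps_X :: rat fps)" (is "?H = ?N / _")
proof -
  \<comment> \<open>The constant term 1 is the value of 2k + 1 at k = 0 and joins the sum.\<close>
  have N: "?N = (\<Sum>k<m. of_nat (2 * k + 1) * fps_X ^ k) + of_nat m * fps_X ^ m"
  proof -
    have "{..<m} = insert 0 {1..m - 1}" using assms by auto
    then show ?thesis by simp
  qed
  have coeff: "fps_nth (of_nat c * fps_X ^ k :: rat fps) n = (if n = k then of_nat c else 0)"
    for c k n
    by (simp add: fps_X_power_nth flip: fps_of_nat)
  have "?H * (1 - fps_X) = ?N"
  proof (rule fps_ext)
    fix n
    have "fps_nth ?N n = (if n < m then of_nat (2 * n + 1) else if n = m then of_nat m else 0)"
      unfolding N fps_add_nth fps_sum_nth coeff by (simp only: sum.delta' finite_lessThan) simp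
    moreover have "fps_nth (?H * (1 - fps_X)) n
        = (if n < m then of_nat (2 * n + 1) else if n = m then of_nat m else 0)"
    proof (cases n)
      case 0
      then show ?thesis using assms by simp
    next
      case (Suc l)
      have "fps_nth (?H * (1 - fps_X)) n = fps_nth ?H (Suc l) - fps_nth ?H l"
        unfolding Suc right_diff_distrib by simp
      also have "\<dots> = (if n < m then of_nat (2 * n + 1) else if n = m then of_nat m else 0)"
        using Suc by (cases n m rule: linorder_cases) (auto simp: power2_eq_square algebra_simps)
      finally show ?thesis .
    qed
    ultimately show "fps_nth (?H * (1 - fps_X)) n = fps_nth ?N n" by simp
  qed
  moreover have "fps_nth (1 - fps_X) 0 \<noteq> (0 :: rat)" by simp
  then have "1 - fps_X \<noteq> (0 :: rat fps)" by (rule fps_nonzeroI)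
  then have "?H * (1 - fps_X) / (1 - fps_X) = ?H" by (rule nonzero_mult_div_cancel_right)
  ultimately show ?thesis by simp
qed

theorem corollary4p9:
  fixes m n1 n2 n3 n4 :: nat
    and R :: "'k::field fps ring"
    and M :: "'k fps set"
  assumes "m \<ge> 2"
    and "n1 = m * (m + 1)"
    and "n2 = m * (m + 1) + 1"
    and "n3 = (m + 1)^2"
    and "n4 = (m + 1)^2 + 1"
    and "R = gen_ring [n1, n2, n3, n4]"
    and "maximalideal M R"
  shows "tangent_cone_hilbert_series (range fps_const) R M =
    (1 + (\<Sum>k = 1..m - 1. of_nat (2 * k + 1) * fps_X ^ k) + of_nat m * fps_X ^ m) / (1 - fps_X)"
proof -
  let ?ns = "[n1, n2, n3, n4]"
  \<comment> \<open>Writing (m + 1)^2 as m(m + 1) + (m + 1) exhibits the pattern b, b + 1, b + c, b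
    + c + 1 with c = m + 1.\<close>
  have "set ?ns = {m * (m + 1), m * (m + 1) + 1, m * (m + 1) + (m + 1), m * (m + 1) + (m + 1) + 1}"
    using assms(2-5) by (simp add: power2_eq_square algebra_simps)
  moreover have "0 \<notin> set ?ns" using assms(1-5) by auto
  ultimately have "tangent_cone_dim (range fps_const) R M n
      = (if n < m then (n + 1)^2 else m * (m + 1))" for n
    using tangent_cone_dim_gen_ring[of ?ns M n] card_sums_ge_G_diff[of "set ?ns" m n] assms by simp
  then show ?thesis
    unfolding tangent_cone_hilbert_series_def using hilbert_series_eq[of m] assms(1) by simp
qed

end
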